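(* Consider the autoregressive process given, for all $k\in[1,n]$, by $X_k=\theta X_{k-1}+\varepsilon_k$, with unknown parameter $\theta$ and least-squares estimator $$\theta_n'=\frac{\sum_{k=1}^nX_kX_{k-1}}{\sum_{k=1}^nX_{k-1}^2}.$$ Assume $|\varepsilon_i|\le\epsilon$ for all $i\in[1,n]$, where $\epsilon$ is a positive constant. Then, for all $x,v>0$, $$\mathbf{P}\left(\pm(\theta_n'-\theta)\sum_{k=1}^nX_{k-1}^2\ge x\ \text{and}\ L_n\le v^2\right)\le\exp\left\{-\frac{x^2}{2v^2}\right\},$$ where $$L_n=\frac14\left(\epsilon+\frac{\sigma^2}{\epsilon}\right)^2\sum_{k=1}^nX_{k-1}^2.$$
   Context: Here $n\ge1$, and $(X_k)$ and $(\varepsilon_k)$ are the real-valued observations and driven noises, respectively, with $X_0$ the initial observation. $(\varepsilon_k)$ is a sequence of i.i.d. centered random variables with variance $\sigma^2>0$. The symbol $\pm$ means that the bound holds for each of the two choices of sign.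
   Formalization: The initial observation X_0 is assumed independent of the noises ε_1,…,ε_n; without this the bound fails, e.g. for n=1, ε_1 a symmetric ±1 variable, X_0=ε_1, ϵ=σ=x=v=1, where the probability is 1. *)

theory Defs
  imports "HOL-Probability.Probability"
begin

definition (in prob_space) iid_on :: "nat set \<Rightarrow> (nat \<Rightarrow> 'a \<Rightarrow> real) \<Rightarrow> bool" where
  "iid_on I Y \<longleftrightarrow> indep_vars (\<lambda>_. borel) Y I \<and>
     (\<forall>i\<in>I. \<forall>j\<in>I. distr M borel (Y i) = distr M borel (Y j))"

(* If all of X_0, ..., X_{n-1} vanish at w, the quotient is 0 by the convention x / 0 = 0.
   Multiplied by the (then zero) sum of squares, its value plays no role. *)
definition ls_estimator :: "(nat \<Rightarrow> 'a \<Rightarrow> real) \<Rightarrow> nat \<Rightarrow> 'a \<Rightarrow> real" where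
  "ls_estimator X n \<omega> =
     (\<Sum>k=1..n. X k \<omega> * X (k - 1) \<omega>) / (\<Sum>k=1..n. (X (k - 1) \<omega>)\<^sup>2)"

definition L_stat :: "real \<Rightarrow> real \<Rightarrow> (nat \<Rightarrow> 'a \<Rightarrow> real) \<Rightarrow> nat \<Rightarrow> 'a \<Rightarrow> real" where
  "L_stat b \<sigma> X n \<omega> =
     1 / 4 * (b + \<sigma>\<^sup>2 / b)\<^sup>2 * (\<Sum>k=1..n. (X (k - 1) \<omega>)\<^sup>2)"

end

theory Submission
  imports Defs
begin

text \<open>
  The product of \<open>\<theta>\<^sub>n' - \<theta>\<close> with the sum of squares is the martingale transform
  \<open>S = \<Sum> X\<^sub>k\<^sub>-\<^sub>1 \<epsilon>\<^sub>k\<close>. A centred variable with variance \<open>s\<close> bounded above by \<open>b\<close> has, by Bennett's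
  argument, a moment generating function dominated by that of the centred law on the two points
  \<open>-s/b\<close> and \<open>b\<close>, to which Hoeffding's lemma applies with an interval of length \<open>b + s/b\<close>. Hence
  \<open>exp (t S - t\<^sup>2 L / 2)\<close> has expectation at most 1 for every real \<open>t\<close>, and Markov's inequality with
  \<open>t = \<plusminus>x/v\<^sup>2\<close> finishes the proof.
\<close>

section \<open>Bennett-type bounds for a bounded centred variable\<close>

text \<open>Taylor's formula with integral remainder, rescaled to the unit interval; an
  antiderivative is \<open>u * (1 - s) * exp (s * u) + exp (s * u)\<close>.\<close>

lemma exp_remainder_has_integral:
  fixes u :: real
  shows "((\<lambda>s. u\<^sup>2 * ((1 - s) * exp (s * u))) has_integral (exp u - 1 - u)) {0..1}"
proof -
  have "((\<lambda>s. u\<^sup>2 * ((1 - s) * exp (s * u))) has_integral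
      ((\<lambda>s. u * (1 - s) * exp (s * u) + exp (s * u)) 1 - (\<lambda>s. u * (1 - s) * exp (s * u) + exp (s * u)) 0)) {0..1}"
    by (rule fundamental_theorem_of_calculus)
       (auto intro!: derivative_eq_intros
             simp: has_real_derivative_iff_has_vector_derivative[symmetric] algebra_simps power2_eq_square)
  then show ?thesis by (simp add: algebra_simps)
qed

text \<open>By the integral formula, \<open>(exp u - 1 - u) / u\<^sup>2\<close> is an average of
  \<open>exp (s * u)\<close> with weight \<open>1 - s\<close>, hence increasing in \<open>u\<close>.
  Comparing the integrals in cross-multiplied form avoids a separate case for
  \<open>u = 0\<close>.\<close>

lemma exp_le_quadratic:
  fixes u w :: real
  assumes "u \<le> w" "w \<noteq> 0"
  shows "exp u \<le> 1 + u + (exp w - 1 - w) / w\<^sup>2 * u\<^sup>2"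
proof -
  have "w\<^sup>2 * (exp u - 1 - u) \<le> u\<^sup>2 * (exp w - 1 - w)"
  proof (rule has_integral_le)
    show "((\<lambda>s. w\<^sup>2 * (u\<^sup>2 * ((1 - s) * exp (s * u)))) has_integral w\<^sup>2 * (exp u - 1 - u)) {0..1}"
      by (intro has_integral_mult_right exp_remainder_has_integral)
    show "((\<lambda>s. u\<^sup>2 * (w\<^sup>2 * ((1 - s) * exp (s * w)))) has_integral u\<^sup>2 * (exp w - 1 - w)) {0..1}"
      by (intro has_integral_mult_right exp_remainder_has_integral)
    fix s :: real assume s: "s \<in> {0..1}"
    have "exp (s * u) \<le> exp (s * w)"
      using s assms by (auto intro: mult_left_mono)
    then have "(w\<^sup>2 * u\<^sup>2 * (1 - s)) * exp (s * u) \<le> (w\<^sup>2 * u\<^sup>2 * (1 - s)) * exp (s * w)"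
      using s by (intro mult_left_mono) auto
    then show "w\<^sup>2 * (u\<^sup>2 * ((1 - s) * exp (s * u))) \<le> u\<^sup>2 * (w\<^sup>2 * ((1 - s) * exp (s * w)))"
      by (simp add: mult_ac)
  qed
  then show ?thesis
    using assms by (simp add: field_simps)
qed

context prob_space
begin

text \<open>The exponential is majorised by a quadratic in \<open>Y\<close>, whose expectation
  depends only on the mean and the variance. The quadratic agrees with the exponential at
  \<open>-s/b\<close> and \<open>b\<close>, so this expectation is exactly the moment generating
  function of the centred law with variance \<open>s\<close> on these two points.\<close>

lemma mgf_le_of_upper_bound:
  fixes Y :: "'a \<Rightarrow> real"
  assumes Y: "integrable M Y" "integrable M (\<lambda>\<omega>. (Y \<omega>)\<^sup>2)"
    and mean: "expectation Y = 0" and var: "expectation (\<lambda>\<omega>. (Y \<omega>)\<^sup>2) = s"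
    and b: "b > 0" "AE \<omega> in M. Y \<omega> \<le> b" and t: "t \<ge> 0"
  shows "(\<integral>\<^sup>+\<omega>. ennreal (exp (t * Y \<omega>)) \<partial>M) \<le> ennreal (exp (t\<^sup>2 * (b + s / b)\<^sup>2 / 8))"
proof (cases "t = 0")
  case True
  then show ?thesis by (simp add: emeasure_space_1)
next
  case False
  \<comment> \<open>The two-point law has atoms \<open>-a\<close> and \<open>b\<close> at distance
    \<open>d\<close>, with masses \<open>b/d\<close> and \<open>a/d\<close>; its variance is
    \<open>a * b = s\<close>.\<close>
  define a d h where "a = s / b" and "d = b + a" and "h = t * d"
  have "s \<ge> 0"
    unfolding var[symmetric] by (rule Bochner_Integration.integral_nonneg) simp
  then have pos: "a \<ge> 0" "d > 0" "h > 0"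
    using b t False by (auto simp: a_def d_def h_def add_pos_nonneg)
  have s: "s = a * b"
    using b by (simp add: a_def)
  \<comment> \<open>With this \<open>K\<close>, the parabola \<open>1 + u + K * u\<^sup>2\<close> is
    tangent to \<open>exp\<close> at \<open>u = 0\<close> (where \<open>Y = -a\<close>) and meets it
    at \<open>u = h\<close> (where \<open>Y = b\<close>).\<close>
  define K where "K = (exp h - 1 - h) / h\<^sup>2"
  define q where "q = (\<lambda>\<omega>. exp (- (t * a)) * (1 + t * (Y \<omega> + a) + K * (t * (Y \<omega> + a))\<^sup>2))"
  have q_alt: "q = (\<lambda>\<omega>. exp (- (t * a)) * (1 + t * a + K * t\<^sup>2 * a\<^sup>2)
      + exp (- (t * a)) * (t + 2 * K * t\<^sup>2 * a) * Y \<omega> + exp (- (t * a)) * (K * t\<^sup>2) * (Y \<omega>)\<^sup>2)"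
    by (auto simp: q_def fun_eq_iff algebra_simps power2_eq_square)
  have exp_le_q: "AE \<omega> in M. exp (t * Y \<omega>) \<le> q \<omega>"
    using b(2)
  proof eventually_elim
    case (elim \<omega>)
    have "exp (t * (Y \<omega> + a)) \<le> 1 + t * (Y \<omega> + a) + K * (t * (Y \<omega> + a))\<^sup>2"
      unfolding K_def using elim t pos
      by (intro exp_le_quadratic) (auto simp: h_def d_def intro!: mult_left_mono)
    then have "exp (- (t * a)) * exp (t * (Y \<omega> + a)) \<le> q \<omega>"
      unfolding q_def by (intro mult_left_mono) auto
    then show ?case
      by (simp flip: exp_add add: algebra_simps)
  qed
  have int_q: "integrable M q"
    unfolding q_alt using Y by auto
  have "(\<integral>\<^sup>+\<omega>. ennreal (exp (t * Y \<omega>)) \<partial>M) \<le> (\<integral>\<^sup>+\<omega>. ennreal (q \<omega>) \<partial>M)"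
    using exp_le_q by (intro nn_integral_mono_AE) (auto elim!: eventually_mono intro: ennreal_leI)
  also have "\<dots> = ennreal (expectation q)"
  proof (rule nn_integral_eq_integral[OF int_q])
    show "AE \<omega> in M. 0 \<le> q \<omega>"
      using exp_le_q by eventually_elim (use exp_ge_zero order_trans in blast)
  qed
  also have "expectation q = exp (- (t * a)) * (1 + t * a + K * t\<^sup>2 * (a\<^sup>2 + s))"
    unfolding q_alt using Y mean var by (simp add: prob_space algebra_simps)
  also have "K * t\<^sup>2 * (a\<^sup>2 + s) = a / d * (exp h - 1 - h)"
  proof -
    have "a\<^sup>2 + s = a * d"
      by (simp add: s d_def algebra_simps power2_eq_square)
    then show ?thesis
      using pos t False by (simp add: K_def h_def power2_eq_square field_simps)
  qed
  also have "t * a = h * (a / d)"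
    using pos by (simp add: h_def)
  also have "1 + h * (a / d) + a / d * (exp h - 1 - h) = 1 + a / d * (exp h - 1)"
    by (simp add: algebra_simps add_divide_distrib)
  \<comment> \<open>The exponent is brought to the form of Hoeffding's lemma, with success
    probability \<open>a / d\<close>.\<close>
  also have "exp (- (h * (a / d))) * (1 + a / d * (exp h - 1))
      = exp (- h * (a / d) + ln (1 + a / d * (exp h - 1)))"
  proof -
    have "1 + a / d * (exp h - 1) > 0"
      using pos by (intro add_pos_nonneg mult_nonneg_nonneg) auto
    then show ?thesis by (simp only: exp_add exp_ln mult_minus_left)
  qed
  also have "\<dots> \<le> exp (h\<^sup>2 / 8)"
    using Hoeffdings_lemma_aux[of h "a / d"] pos by simp
  also have "h\<^sup>2 / 8 = t\<^sup>2 * (b + s / b)\<^sup>2 / 8"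
    by (simp add: h_def d_def a_def power_mult_distrib)
  finally show ?thesis
    by (simp add: ennreal_leI)
qed

text \<open>For negative \<open>t\<close>, the one-sided bound is applied to \<open>- Y\<close> and
  \<open>- t\<close>: the reflection preserves the mean zero and the second moment.\<close>

lemma mgf_le_of_bound:
  fixes Y :: "'a \<Rightarrow> real"
  assumes Y: "integrable M Y" "integrable M (\<lambda>\<omega>. (Y \<omega>)\<^sup>2)"
    and mean: "expectation Y = 0" and var: "expectation (\<lambda>\<omega>. (Y \<omega>)\<^sup>2) = s"
    and b: "b > 0" "AE \<omega> in M. \<bar>Y \<omega>\<bar> \<le> b"
  shows "(\<integral>\<^sup>+\<omega>. ennreal (exp (t * Y \<omega>)) \<partial>M) \<le> ennreal (exp (t\<^sup>2 * (b + s / b)\<^sup>2 / 8))"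
proof (cases "t \<ge> 0")
  case True
  then show ?thesis
    using assms by (intro mgf_le_of_upper_bound) (auto elim!: eventually_mono)
next
  case False
  have "(\<integral>\<^sup>+\<omega>. ennreal (exp (- t * - Y \<omega>)) \<partial>M) \<le> ennreal (exp ((- t)\<^sup>2 * (b + s / b)\<^sup>2 / 8))"
    using assms False by (intro mgf_le_of_upper_bound) (auto elim!: eventually_mono)
  then show ?thesis by simp
qed

section \<open>Exponential supermartingale and Markov bound\<close>

text \<open>Independence makes the joint law a product, so Tonelli's theorem applies. This takes the
  place of conditioning on \<open>U\<close>: its value is frozen while \<open>Y\<close> is
  integrated out.\<close>

lemma indep_var_nn_integral_iterated:
  assumes ind: "indep_var S U T Y" and f [measurable]: "f \<in> borel_measurable (S \<Otimes>\<^sub>M T)"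
  shows "(\<integral>\<^sup>+\<omega>. f (U \<omega>, Y \<omega>) \<partial>M) = (\<integral>\<^sup>+\<omega>. (\<integral>\<^sup>+\<omega>'. f (U \<omega>, Y \<omega>') \<partial>M) \<partial>M)"
proof -
  have [measurable]: "random_variable S U" "random_variable T Y"
    using ind by (auto dest: indep_var_rv1 indep_var_rv2)
  interpret T: prob_space "distr M T Y"
    by (rule prob_space_distr) measurable
  have "(\<integral>\<^sup>+\<omega>. f (U \<omega>, Y \<omega>) \<partial>M) = (\<integral>\<^sup>+p. f p \<partial>distr M (S \<Otimes>\<^sub>M T) (\<lambda>\<omega>. (U \<omega>, Y \<omega>)))"
    by (subst nn_integral_distr) auto
  also have "distr M (S \<Otimes>\<^sub>M T) (\<lambda>\<omega>. (U \<omega>, Y \<omega>)) = distr M S U \<Otimes>\<^sub>M distr M T Y"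
    using ind by (simp add: indep_var_distribution_eq)
  also have "(\<integral>\<^sup>+p. f p \<partial>(distr M S U \<Otimes>\<^sub>M distr M T Y))
      = (\<integral>\<^sup>+u. (\<integral>\<^sup>+y. f (u, y) \<partial>distr M T Y) \<partial>distr M S U)"
    by (rule T.nn_integral_fst[symmetric]) simp
  also have "\<dots> = (\<integral>\<^sup>+\<omega>. (\<integral>\<^sup>+y. f (U \<omega>, y) \<partial>distr M T Y) \<partial>M)"
    by (rule nn_integral_distr) measurable
  also have "\<dots> = (\<integral>\<^sup>+\<omega>. (\<integral>\<^sup>+\<omega>'. f (U \<omega>, Y \<omega>') \<partial>M) \<partial>M)"
    by (intro nn_integral_cong nn_integral_distr) (auto intro: measurable_Pair2 measurable_space)
  finally show ?thesis .
qed

text \<open>The weight \<open>H k\<close> sees only the coordinates up to \<open>k\<close> and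
  multiplies the next one, so it is predictable. In the induction the past is frozen and the newest
  variable integrated out; the resulting factor is absorbed by the compensator
  \<open>(H k)\<^sup>2 * c\<close>.\<close>

lemma nn_integral_exp_martingale_transform_le:
  fixes Z :: "nat \<Rightarrow> 'a \<Rightarrow> real" and H :: "nat \<Rightarrow> (nat \<Rightarrow> real) \<Rightarrow> real"
  defines "past k \<omega> \<equiv> restrict (\<lambda>i. Z i \<omega>) {0..k}"
  assumes ind: "indep_vars (\<lambda>_. borel) Z {0..n}"
    and H: "\<And>k. k < n \<Longrightarrow> H k \<in> borel_measurable (Pi\<^sub>M {0..k} (\<lambda>_. borel))"
    and mgf: "\<And>k t. k \<in> {1..n} \<Longrightarrow> (\<integral>\<^sup>+\<omega>. ennreal (exp (t * Z k \<omega>)) \<partial>M) \<le> ennreal (exp (t\<^sup>2 * c))"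
    and "m \<le> n"
  shows "(\<integral>\<^sup>+\<omega>. ennreal (exp (\<Sum>k<m. H k (past k \<omega>) * Z (Suc k) \<omega> - (H k (past k \<omega>))\<^sup>2 * c)) \<partial>M) \<le> 1"
  using \<open>m \<le> n\<close>
proof (induction m)
  case 0
  then show ?case by (simp add: emeasure_space_1)
next
  case (Suc m)
  \<comment> \<open>Each increment restricts its argument itself, so that all earlier increments
    become functions on the single product space \<open>?P\<close>.\<close>
  define D where "D k z = H k (restrict z {0..k}) * z (Suc k) - (H k (restrict z {0..k}))\<^sup>2 * c" for k z
  define W where "W z = (\<Sum>k<m. D k z)" for z
  let ?P = "Pi\<^sub>M {0..m} (\<lambda>_. borel :: real measure)"
  have D [measurable]: "D k \<in> borel_measurable ?P" if "k < m" for k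
  proof -
    have "(\<lambda>z. H k (restrict z {0..k})) \<in> borel_measurable ?P"
      using that Suc.prems
      by (intro measurable_compose[OF measurable_restrict_subset H]) auto
    moreover have "(\<lambda>z. z (Suc k)) \<in> borel_measurable ?P"
      using that by (intro measurable_component_singleton) auto
    ultimately show ?thesis
      unfolding D_def by measurable
  qed
  have W [measurable]: "W \<in> borel_measurable ?P"
    unfolding W_def by (intro borel_measurable_sum D) auto
  have Hm [measurable]: "H m \<in> borel_measurable ?P"
    using H[of m] Suc.prems by simp
  have past [measurable]: "past m \<in> measurable M ?P"
    unfolding past_def using ind Suc.prems
    by (intro measurable_restrict) (auto simp: indep_vars_def)
  let ?Q = "Pi\<^sub>M {Suc m} (\<lambda>_. borel :: real measure)"
  \<comment> \<open>The next variable is kept as a family over a singleton, because independence of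
    disjoint blocks is stated for restricted families.\<close>
  define new where "new \<omega> = restrict (\<lambda>i. Z i \<omega>) {Suc m}" for \<omega>
  have indep: "indep_var ?P (past m) ?Q new"
    unfolding past_def[abs_def] new_def[abs_def]
    using Suc.prems by (intro indep_var_restrict[OF ind]) auto
  have sum_eq: "(\<Sum>k<m. H k (past k \<omega>) * Z (Suc k) \<omega> - (H k (past k \<omega>))\<^sup>2 * c) = W (past m \<omega>)" for \<omega>
    unfolding W_def D_def past_def by (intro sum.cong refl) (auto simp: min_absorb2 Int_absorb1)
  define f where "f = (\<lambda>(z, y). ennreal (exp (W z - (H m z)\<^sup>2 * c)) * ennreal (exp (H m z * y (Suc m))))"
  have f [measurable]: "f \<in> borel_measurable (?P \<Otimes>\<^sub>M ?Q)"
    unfolding f_def using measurable_component_singleton[of "Suc m" "{Suc m}" "\<lambda>_. borel :: real measure"]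
    by measurable
  have "(\<integral>\<^sup>+\<omega>. ennreal (exp (\<Sum>k<Suc m. H k (past k \<omega>) * Z (Suc k) \<omega> - (H k (past k \<omega>))\<^sup>2 * c)) \<partial>M)
      = (\<integral>\<^sup>+\<omega>. f (past m \<omega>, new \<omega>) \<partial>M)"
    by (intro nn_integral_cong)
       (simp add: f_def new_def sum_eq flip: ennreal_mult exp_add)
  also have "\<dots> = (\<integral>\<^sup>+\<omega>. (\<integral>\<^sup>+\<omega>'. f (past m \<omega>, new \<omega>') \<partial>M) \<partial>M)"
    by (rule indep_var_nn_integral_iterated[OF indep f])
  also have "\<dots> \<le> (\<integral>\<^sup>+\<omega>. ennreal (exp (W (past m \<omega>))) \<partial>M)"
  proof (rule nn_integral_mono)
    fix \<omega>
    have [measurable]: "Z (Suc m) \<in> borel_measurable M"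
      using ind Suc.prems by (auto simp: indep_vars_def)
    have "(\<integral>\<^sup>+\<omega>'. f (past m \<omega>, new \<omega>') \<partial>M)
        = ennreal (exp (W (past m \<omega>) - (H m (past m \<omega>))\<^sup>2 * c))
          * (\<integral>\<^sup>+\<omega>'. ennreal (exp (H m (past m \<omega>) * Z (Suc m) \<omega>')) \<partial>M)"
      unfolding f_def new_def by (simp add: nn_integral_cmult)
    \<comment> \<open>With the past frozen, \<open>H m (past m \<omega>)\<close> is a constant and
      serves as the parameter \<open>t\<close> of the hypothesis \<open>mgf\<close>.\<close>
    also have "\<dots> \<le> ennreal (exp (W (past m \<omega>) - (H m (past m \<omega>))\<^sup>2 * c))
          * ennreal (exp ((H m (past m \<omega>))\<^sup>2 * c))"
      using Suc.prems by (intro mult_left_mono mgf) auto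
    also have "\<dots> = ennreal (exp (W (past m \<omega>)))"
      by (simp flip: ennreal_mult exp_add)
    finally show "(\<integral>\<^sup>+\<omega>'. f (past m \<omega>, new \<omega>') \<partial>M) \<le> ennreal (exp (W (past m \<omega>)))" .
  qed
  also have "\<dots> \<le> 1"
    using Suc.IH Suc.prems by (simp add: sum_eq)
  finally show ?case .
qed

text \<open>Markov's inequality for \<open>exp W\<close>. The event enters only through its
  inclusion in \<open>r \<le> W\<close>, so measurability is asked of \<open>W\<close>
  alone.\<close>

lemma prob_le_exp_of_nn_integral_exp_le_1:
  fixes W :: "'a \<Rightarrow> real"
  assumes W [measurable]: "W \<in> borel_measurable M"
    and "(\<integral>\<^sup>+\<omega>. ennreal (exp (W \<omega>)) \<partial>M) \<le> 1"
    and sub: "\<And>\<omega>. \<omega> \<in> space M \<Longrightarrow> P \<omega> \<Longrightarrow> r \<le> W \<omega>"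
  shows "\<P>(\<omega> in M. P \<omega>) \<le> exp (- r)"
proof -
  have "prob {\<omega> \<in> space M. P \<omega>} \<le> prob {\<omega> \<in> space M. r \<le> W \<omega>}"
    using sub by (intro finite_measure_mono) auto
  also have "\<dots> \<le> exp (- r)"
  proof -
    have "emeasure M {\<omega> \<in> space M. r \<le> W \<omega>}
        \<le> emeasure M {\<omega> \<in> space M. 1 \<le> ennreal (exp (- r)) * ennreal (exp (W \<omega>))}"
      by (intro emeasure_mono)
         (auto simp flip: ennreal_mult exp_add simp: ennreal_ge_1)
    also have "\<dots> \<le> ennreal (exp (- r)) * (\<integral>\<^sup>+\<omega>. ennreal (exp (W \<omega>)) * indicator (space M) \<omega> \<partial>M)"
      by (rule nn_integral_Markov_inequality) auto
    also have "(\<integral>\<^sup>+\<omega>. ennreal (exp (W \<omega>)) * indicator (space M) \<omega> \<partial>M) = (\<integral>\<^sup>+\<omega>. ennreal (exp (W \<omega>)) \<partial>M)"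
      by (intro nn_integral_cong) auto
    also have "ennreal (exp (- r)) * \<dots> \<le> ennreal (exp (- r)) * 1"
      by (intro mult_left_mono assms) auto
    finally show ?thesis
      by (simp add: emeasure_eq_measure)
  qed
  finally show ?thesis .
qed

end

section \<open>The autoregressive path and the estimation error\<close>

text \<open>Solves the recursion pathwise: coordinate 0 of \<open>z\<close> is the initial
  observation, the others are the noises. It exhibits the observations as measurable functions of
  the past, as predictable weights must be.\<close>

fun ar_path :: "real \<Rightarrow> (nat \<Rightarrow> real) \<Rightarrow> nat \<Rightarrow> real" where
  "ar_path \<theta> z 0 = z 0"
| "ar_path \<theta> z (Suc k) = \<theta> * ar_path \<theta> z k + z (Suc k)"

lemma ar_path_cong: "(\<And>i. i \<le> k \<Longrightarrow> z i = z' i) \<Longrightarrow> ar_path \<theta> z k = ar_path \<theta> z' k"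
  by (induction k) auto

lemma measurable_ar_path:
  "k \<le> m \<Longrightarrow> (\<lambda>z. ar_path \<theta> z k) \<in> borel_measurable (Pi\<^sub>M {0..m} (\<lambda>_. borel))"
proof (induction k)
  case 0
  then show ?case by (simp add: measurable_component_singleton)
next
  case (Suc k)
  have [measurable]: "(\<lambda>z. ar_path \<theta> z k) \<in> borel_measurable (Pi\<^sub>M {0..m} (\<lambda>_. borel))"
    using Suc by simp
  have [measurable]: "(\<lambda>z. z (Suc k)) \<in> borel_measurable (Pi\<^sub>M {0..m} (\<lambda>_. borel :: real measure))"
    using Suc.prems by (intro measurable_component_singleton) auto
  show ?case by simp
qed

text \<open>Inserting the recursion into the numerator of the estimator splits off
  \<open>\<theta>\<close> times the denominator and leaves the noise sum.\<close>

lemma ls_estimator_error: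
  assumes "\<And>k. k \<in> {1..n} \<Longrightarrow> X k \<omega> = \<theta> * X (k - 1) \<omega> + \<epsilon> k \<omega>"
  shows "(ls_estimator X n \<omega> - \<theta>) * (\<Sum>k=1..n. (X (k - 1) \<omega>)\<^sup>2) = (\<Sum>k=1..n. X (k - 1) \<omega> * \<epsilon> k \<omega>)"
proof -
  let ?V = "\<Sum>k=1..n. (X (k - 1) \<omega>)\<^sup>2"
  have num: "(\<Sum>k=1..n. X k \<omega> * X (k - 1) \<omega>) = \<theta> * ?V + (\<Sum>k=1..n. X (k - 1) \<omega> * \<epsilon> k \<omega>)"
    unfolding sum_distrib_left sum.distrib[symmetric]
    by (intro sum.cong refl) (subst assms, auto simp: algebra_simps power2_eq_square)
  show ?thesis
  proof (cases "?V = 0")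
    \<comment> \<open>The denominator cannot be cancelled here, but every
      \<open>X (k - 1) \<omega>\<close> vanishes, so both sides are zero.\<close>
    case True
    then have "\<forall>k\<in>{1..n}. X (k - 1) \<omega> = 0"
      by (subst (asm) sum_nonneg_eq_0_iff) auto
    then have "(\<Sum>k=1..n. X (k - 1) \<omega> * \<epsilon> k \<omega>) = 0"
      by (intro sum.neutral) auto
    with True show ?thesis by simp
  next
    case False
    then show ?thesis
      unfolding ls_estimator_def num by (simp add: field_simps)
  qed
qed

theorem theorem3p6:
  fixes M :: "'a measure" and X \<epsilon> :: "nat \<Rightarrow> 'a \<Rightarrow> real"
    and n :: nat and \<theta> \<sigma> b x v :: real
  assumes "prob_space M"
    and "n \<ge> 1"
    and "prob_space.iid_on M {1..n} \<epsilon>"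
    and "\<And>k. k \<in> {1..n} \<Longrightarrow> integrable M (\<epsilon> k)"
    and "\<And>k. k \<in> {1..n} \<Longrightarrow> prob_space.expectation M (\<epsilon> k) = 0"
    and "\<And>k. k \<in> {1..n} \<Longrightarrow> integrable M (\<lambda>\<omega>. (\<epsilon> k \<omega>)\<^sup>2)"
    and "\<And>k. k \<in> {1..n} \<Longrightarrow> prob_space.variance M (\<epsilon> k) = \<sigma>\<^sup>2"
    and "\<sigma>\<^sup>2 > 0"
    and "prob_space.indep_vars M (\<lambda>_. borel) (\<lambda>k. if k = 0 then X 0 else \<epsilon> k) {0..n}"
    and "\<And>k \<omega>. k \<in> {1..n} \<Longrightarrow> \<omega> \<in> space M \<Longrightarrow> X k \<omega> = \<theta> * X (k - 1) \<omega> + \<epsilon> k \<omega>"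
    and "b > 0"
    and "\<And>i. i \<in> {1..n} \<Longrightarrow> AE \<omega> in M. \<bar>\<epsilon> i \<omega>\<bar> \<le> b"
    and "x > 0" and "v > 0"
  shows "\<P>(\<omega> in M. (ls_estimator X n \<omega> - \<theta>) * (\<Sum>k=1..n. (X (k - 1) \<omega>)\<^sup>2) \<ge> x
            \<and> L_stat b \<sigma> X n \<omega> \<le> v\<^sup>2) \<le> exp (- (x\<^sup>2 / (2 * v\<^sup>2)))
       \<and> \<P>(\<omega> in M. - (ls_estimator X n \<omega> - \<theta>) * (\<Sum>k=1..n. (X (k - 1) \<omega>)\<^sup>2) \<ge> x
            \<and> L_stat b \<sigma> X n \<omega> \<le> v\<^sup>2) \<le> exp (- (x\<^sup>2 / (2 * v\<^sup>2)))"
proof -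
  interpret prob_space M by fact
  \<comment> \<open>The initial observation occupies index 0, so the joint independence covers it
    together with the noises.\<close>
  define Z where "Z = (\<lambda>k. if k = 0 then X 0 else \<epsilon> k)"
  have ind: "indep_vars (\<lambda>_. borel) Z {0..n}"
    using assms(9) by (simp add: Z_def)
  have Z_meas [measurable]: "Z k \<in> borel_measurable M" if "k \<le> n" for k
    using ind that by (auto simp: indep_vars_def)
  have X_eq: "X k \<omega> = ar_path \<theta> (restrict (\<lambda>i. Z i \<omega>) {0..k}) k" if "k \<le> n" "\<omega> \<in> space M" for k \<omega>
  proof -
    have "X k \<omega> = ar_path \<theta> (\<lambda>i. Z i \<omega>) k"
      using that(1)
    proof (induction k)
      case (Suc k)
      then show ?case
        using assms(10)[of "Suc k" \<omega>] that(2) by (simp add: Z_def)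
    qed (simp add: Z_def)
    also have "\<dots> = ar_path \<theta> (restrict (\<lambda>i. Z i \<omega>) {0..k}) k"
      by (rule ar_path_cong) simp
    finally show ?thesis .
  qed
  \<comment> \<open>Chosen so that \<open>t\<^sup>2 * c\<close> is the exponent of the moment bound;
    then \<open>L_stat\<close> equals \<open>2 * c\<close> times the sum of squares.\<close>
  define c where "c = (b + \<sigma>\<^sup>2 / b)\<^sup>2 / 8"
  have mgf: "(\<integral>\<^sup>+\<omega>. ennreal (exp (t * Z k \<omega>)) \<partial>M) \<le> ennreal (exp (t\<^sup>2 * c))" if "k \<in> {1..n}" for k t
  proof -
    have "expectation (\<lambda>\<omega>. (\<epsilon> k \<omega>)\<^sup>2) = \<sigma>\<^sup>2"
      using assms(5)[OF that] assms(7)[OF that] by simp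
    then have "(\<integral>\<^sup>+\<omega>. ennreal (exp (t * \<epsilon> k \<omega>)) \<partial>M) \<le> ennreal (exp (t\<^sup>2 * (b + \<sigma>\<^sup>2 / b)\<^sup>2 / 8))"
      using assms that by (intro mgf_le_of_bound) auto
    then show ?thesis
      using that by (simp add: Z_def c_def)
  qed
  define S where "S \<omega> = (\<Sum>k=1..n. X (k - 1) \<omega> * \<epsilon> k \<omega>)" for \<omega>
  define V where "V \<omega> = (\<Sum>k=1..n. (X (k - 1) \<omega>)\<^sup>2)" for \<omega>
  have X_meas [measurable]: "X k \<in> borel_measurable M" if "k \<le> n" for k
  proof -
    have "(\<lambda>\<omega>. ar_path \<theta> (restrict (\<lambda>i. Z i \<omega>) {0..k}) k) \<in> borel_measurable M"
      using that by (intro measurable_compose[OF _ measurable_ar_path[OF order_refl]] measurable_restrict) auto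
    then show ?thesis
      using X_eq[OF that] by (subst measurable_cong) auto
  qed
  have \<epsilon>_meas: "\<epsilon> k \<in> borel_measurable M" if "k \<in> {1..n}" for k
    using Z_meas[of k] that by (simp add: Z_def)
  have meas [measurable]: "S \<in> borel_measurable M" "V \<in> borel_measurable M"
    unfolding S_def V_def
    by (auto intro!: borel_measurable_sum borel_measurable_times borel_measurable_power X_meas \<epsilon>_meas)
  have supermartingale: "(\<integral>\<^sup>+\<omega>. ennreal (exp (t * S \<omega> - t\<^sup>2 * c * V \<omega>)) \<partial>M) \<le> 1" for t
  proof -
    \<comment> \<open>The weight of the noise at \<open>Suc k\<close> is \<open>t * X k\<close>,
      hence the index shift in the sums below.\<close>
    let ?H = "\<lambda>k z. t * ar_path \<theta> z k"
    have "(\<integral>\<^sup>+\<omega>. ennreal (exp (t * S \<omega> - t\<^sup>2 * c * V \<omega>)) \<partial>M)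
        = (\<integral>\<^sup>+\<omega>. ennreal (exp (\<Sum>k<n. ?H k (restrict (\<lambda>i. Z i \<omega>) {0..k}) * Z (Suc k) \<omega>
            - (?H k (restrict (\<lambda>i. Z i \<omega>) {0..k}))\<^sup>2 * c)) \<partial>M)"
    proof (intro nn_integral_cong arg_cong[where f = "\<lambda>r. ennreal (exp r)"])
      fix \<omega> assume \<omega>: "\<omega> \<in> space M"
      have "t * S \<omega> - t\<^sup>2 * c * V \<omega>
          = (\<Sum>k=1..n. t * X (k - 1) \<omega> * \<epsilon> k \<omega> - (t * X (k - 1) \<omega>)\<^sup>2 * c)"
        by (simp add: S_def V_def sum_distrib_left sum_subtractf power_mult_distrib mult_ac)
      also have "\<dots> = (\<Sum>k<n. t * X k \<omega> * \<epsilon> (Suc k) \<omega> - (t * X k \<omega>)\<^sup>2 * c)"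
        by (simp add: sum.atLeast1_atMost_eq)
      also have "\<dots> = (\<Sum>k<n. ?H k (restrict (\<lambda>i. Z i \<omega>) {0..k}) * Z (Suc k) \<omega>
            - (?H k (restrict (\<lambda>i. Z i \<omega>) {0..k}))\<^sup>2 * c)"
        using \<omega> by (intro sum.cong refl) (simp add: X_eq Z_def)
      finally show "t * S \<omega> - t\<^sup>2 * c * V \<omega> = \<dots>" .
    qed
    also have "\<dots> \<le> 1"
      by (rule nn_integral_exp_martingale_transform_le[OF ind _ mgf order_refl])
         (auto intro!: borel_measurable_times measurable_ar_path)
    finally show ?thesis .
  qed
  \<comment> \<open>The factor \<open>\<delta>\<close>, equal to 1 or -1, treats both signs at
    once.\<close>
  have tail: "\<P>(\<omega> in M. \<delta> * (ls_estimator X n \<omega> - \<theta>) * (\<Sum>k=1..n. (X (k - 1) \<omega>)\<^sup>2) \<ge> x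
      \<and> L_stat b \<sigma> X n \<omega> \<le> v\<^sup>2) \<le> exp (- (x\<^sup>2 / (2 * v\<^sup>2)))" if "\<delta>\<^sup>2 = 1" for \<delta> :: real
  proof (rule prob_le_exp_of_nn_integral_exp_le_1[OF _ supermartingale[of "\<delta> * x / v\<^sup>2"]])
    fix \<omega> assume \<omega>: "\<omega> \<in> space M"
      and ev: "\<delta> * (ls_estimator X n \<omega> - \<theta>) * (\<Sum>k=1..n. (X (k - 1) \<omega>)\<^sup>2) \<ge> x
        \<and> L_stat b \<sigma> X n \<omega> \<le> v\<^sup>2"
    have "(ls_estimator X n \<omega> - \<theta>) * (\<Sum>k=1..n. (X (k - 1) \<omega>)\<^sup>2) = S \<omega>"
      unfolding S_def using assms(10) \<omega> by (intro ls_estimator_error)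
    with ev have S: "x \<le> \<delta> * S \<omega>"
      by (metis mult.assoc)
    have L: "2 * (c * V \<omega>) \<le> v\<^sup>2"
      using ev by (simp add: L_stat_def c_def V_def)
    \<comment> \<open>The value \<open>x / v\<^sup>2\<close> maximises
      \<open>t * x - t\<^sup>2 * v\<^sup>2 / 2\<close> over \<open>t\<close>, and the maximum is the
      claimed exponent.\<close>
    have "x\<^sup>2 / (2 * v\<^sup>2) = x / v\<^sup>2 * x - (x / v\<^sup>2)\<^sup>2 * (v\<^sup>2 / 2)"
      using \<open>v > 0\<close> by (simp add: field_simps power2_eq_square)
    also have "\<dots> \<le> x / v\<^sup>2 * (\<delta> * S \<omega>) - (x / v\<^sup>2)\<^sup>2 * (c * V \<omega>)"
      using S L \<open>x > 0\<close> by (intro diff_mono mult_left_mono) auto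
    also have "\<dots> = \<delta> * x / v\<^sup>2 * S \<omega> - (\<delta> * x / v\<^sup>2)\<^sup>2 * c * V \<omega>"
      using that by (simp add: power_mult_distrib power_divide mult_ac)
    finally show "x\<^sup>2 / (2 * v\<^sup>2) \<le> \<delta> * x / v\<^sup>2 * S \<omega> - (\<delta> * x / v\<^sup>2)\<^sup>2 * c * V \<omega>" .
  qed measurable
  show ?thesis
    using tail[of 1] tail[of "-1"] by simp
qed

end
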